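(* For any rational $\beta=p/q>1$, the set $M_{\beta,0}$ is contained in the connectedness locus $M_\beta$.
   Context: Here $p>q\ge 1$ are integers with $\beta=p/q$. For $c\in\mathbb{C}$, $\mathbf{f}_c(z)=\{w:(w-c)^q=z^p\}$ for $z\in\mathbb{C}$. A forward orbit is a sequence with $z_{i+1}\in\mathbf{f}_c(z_i)$ for every $i$. The filled Julia set $K_c$ is the set of points $z\in\mathbb{C}$ having at least one bounded forward orbit under $\mathbf{f}_c$; equivalently $K_c=\bigcap_{k\ge 0}\mathbf{f}_c^{-k}(B_R)$ with $B_R=\{|z|<R\}$, for $R$ larger than the greatest solution $x$ of $x^{p/q}-\lambda x-|c|=0$ (any fixed $\lambda>1$), where $\mathbf{f}_c^{-1}(A)=\{z:\mathbf{f}_c(z)\cap A\neq\emptyset\}$. $M_\beta=\{c\in\mathbb{C}:K_c\text{ is connected}\}$ and $M_{\beta,0}=\{c\in\mathbb{C}:0\in K_c\}$. *)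

theory Defs
  imports "HOL-Analysis.Analysis"
begin

text \<open>
  The exponent \<open>\<beta> = p/q\<close> is represented by the pair \<open>(p, q)\<close>, which need not be in lowest
  terms: the correspondence depends on the pair and not only on the quotient.
\<close>

definition corr :: "nat \<Rightarrow> nat \<Rightarrow> complex \<Rightarrow> complex \<Rightarrow> complex set" where
  "corr p q c z = {w. (w - c) ^ q = z ^ p}"

definition forward_orbit :: "nat \<Rightarrow> nat \<Rightarrow> complex \<Rightarrow> (nat \<Rightarrow> complex) \<Rightarrow> bool" where
  "forward_orbit p q c \<zeta> \<longleftrightarrow> (\<forall>i. \<zeta> (Suc i) \<in> corr p q c (\<zeta> i))"

definition filled_julia :: "nat \<Rightarrow> nat \<Rightarrow> complex \<Rightarrow> complex set" where
  "filled_julia p q c =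
     {z. \<exists>\<zeta>. forward_orbit p q c \<zeta> \<and> \<zeta> 0 = z \<and> bounded (range \<zeta>)}"

definition connectedness_locus :: "nat \<Rightarrow> nat \<Rightarrow> complex set" where
  "connectedness_locus p q = {c. connected (filled_julia p q c)}"

text \<open>The set \<open>M\<^sub>\<beta>\<^sub>,\<^sub>0\<close>.\<close>

definition zero_locus :: "nat \<Rightarrow> nat \<Rightarrow> complex set" where
  "zero_locus p q = {c. 0 \<in> filled_julia p q c}"

end

theory Submission
  imports Defs "HOL-Complex_Analysis.Conformal_Mappings"
begin

text \<open>
  Far from the origin the correspondence at least doubles the modulus, because \<open>p > q\<close>.  Hence a
  large closed disc traps every bounded orbit, and pulling it back repeatedly under the
  correspondence gives a decreasing sequence of compact sets whose intersection is the filled Julia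
  set (\<open>filled_julia_eq_Inter_trapped\<close>).  A decreasing intersection of compact connected sets
  is connected, so everything comes down to the connectedness of the iterated preimages of the disc.

  One pullback step factors as \<open>w \<mapsto> (w - c)\<^sup>q\<close> followed by the inverse image under \<open>z \<mapsto> z\<^sup>p\<close>.
  Taking the image preserves connectedness.  The inverse image does so as well, provided that the
  set contains the critical value \<open>0\<close> of the power map: the map is open and proper, so every
  nonempty clopen part of the inverse image is mapped onto the whole connected set and thus contains
  the only preimage of \<open>0\<close>; two disjoint nonempty clopen parts are therefore impossible
  (\<open>connected_vimage_open_map\<close>).

  The proviso is where the hypothesis \<open>0 \<in> K\<^sub>c\<close> enters.  The only successor of \<open>0\<close> is
  \<open>c\<close>, so if \<open>0\<close> survives arbitrarily many pullbacks then so does \<open>c\<close>, and \<open>w = c\<close> is the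
  point at which \<open>(w - c)\<^sup>q = 0\<close>.
\<close>

section \<open>Inverse images of connected sets under open maps\<close>

text \<open>
  A clopen subset of the inverse image has a clopen image: open because \<open>f\<close> is an open map, closed
  because the inverse image is compact.  By connectedness this image is everything or empty, so
  every nonempty clopen subset contains the one point \<open>x\<close> over \<open>v\<close>.  A clopen set and its complement
  cannot both contain \<open>x\<close>, hence one of them is empty.
\<close>

lemma connected_vimage_open_map:
  fixes f :: "'a::t2_space \<Rightarrow> 'b::t2_space"
  assumes cont: "continuous_on UNIV f"
    and open_map: "\<And>U. open U \<Longrightarrow> open (f ` U)"
    and surj: "surj f"
    and B: "connected B" "compact (f -` B)"
    and v: "v \<in> B" "f -` {v} = {x}"
  shows "connected (f -` B)"
proof -
  let ?S = "f -` B"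
  have image_B: "f ` ?S = B"
    using surj by (simp add: surj_image_vimage_eq)
  have meets_fibre: "x \<in> T"
    if T: "openin (top_of_set ?S) T" "closedin (top_of_set ?S) T" "T \<noteq> {}" for T
  proof -
    obtain U where U: "open U" "T = ?S \<inter> U"
      using T(1) by (auto simp: openin_open)
    have "f ` T = B \<inter> f ` U"
      using U(2) image_B by auto
    then have op: "openin (top_of_set B) (f ` T)"
      using open_map[OF U(1)] by (auto simp: openin_open)
    have "compact T"
      using T(2) B(2) by (rule closedin_compact[rotated])
    then have "compact (f ` T)"
      using cont by (meson compact_continuous_image continuous_on_subset subset_UNIV)
    then have "closedin (top_of_set B) (f ` T)"
      using op by (simp add: compact_imp_closed closed_subset openin_imp_subset)
    with op B(1) T(3) have "f ` T = B"
      by (metis connected_clopen image_is_empty)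
    then obtain y where "y \<in> T" "f y = v"
      using v(1) by auto
    with v(2) show ?thesis by auto
  qed
  show ?thesis
    unfolding connected_clopen
  proof (intro allI impI)
    fix T assume T: "openin (top_of_set ?S) T \<and> closedin (top_of_set ?S) T"
    then have "openin (top_of_set ?S) (?S - T)" "closedin (top_of_set ?S) (?S - T)"
      by (simp_all add: openin_diff closedin_diff)
    moreover have "T \<subseteq> ?S"
      using T openin_imp_subset by blast
    ultimately show "T = {} \<or> T = ?S"
      using T meets_fibre[of T] meets_fibre[of "?S - T"] by blast
  qed
qed

lemma surj_complex_power:
  assumes "0 < n"
  shows "surj (\<lambda>z::complex. z ^ n)"
  unfolding surj_def
proof
  fix w :: complex
  show "\<exists>z. w = z ^ n"
  proof (cases "w = 0")
    case False
    then show ?thesis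
      using exists_complex_root_nonzero[of w n] assms by (metis neq0_conv)
  qed (use assms in auto)
qed

lemma open_image_complex_power:
  assumes "0 < n" "open U"
  shows "open ((\<lambda>z::complex. z ^ n) ` U)"
proof (rule open_mapping_thm[where S = UNIV])
  show "\<not> (\<lambda>z::complex. z ^ n) constant_on UNIV"
    using assms(1) unfolding constant_on_def
    by (metis UNIV_I power_one zero_neq_one zero_power)
qed (use assms in \<open>auto intro!: holomorphic_intros\<close>)

section \<open>Escape to infinity\<close>

text \<open>
  Let \<open>r\<close> be the modulus of \<open>z\<close>.  Since \<open>r \<ge> 3\<^sup>q\<close> and \<open>p > q\<close>, the \<open>q\<close>-th power of the modulus of
  \<open>w - c\<close> is \<open>r\<^sup>p \<ge> r \<cdot> r\<^sup>q \<ge> (3 r)\<^sup>q\<close>, so that modulus is at least \<open>3 r\<close>.  The constant \<open>3\<close> leaves a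
  factor \<open>2\<close> after the translation by \<open>c\<close> has been absorbed into one \<open>r\<close>.
\<close>

lemma corr_doubles_norm:
  assumes "1 \<le> q" "q < p" "3 ^ q \<le> norm z" "norm c \<le> norm z" "w \<in> corr p q c z"
  shows "2 * norm z \<le> norm w"
proof -
  have "1 \<le> (3::real) ^ q" by simp
  with assms(3) have r1: "1 \<le> norm z" by linarith
  have "(3 * norm z) ^ q \<le> norm z * norm z ^ q"
    using assms(3) by (simp add: power_mult_distrib mult_right_mono)
  also have "\<dots> \<le> norm z ^ p"
    using power_increasing[of "Suc q" p "norm z"] assms(2) r1 by simp
  also have "\<dots> = norm (w - c) ^ q"
    using assms(5) unfolding corr_def norm_power[symmetric] by simp
  finally have "(3 * norm z) ^ q \<le> norm (w - c) ^ q" .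
  then have "3 * norm z \<le> norm (w - c)"
    using assms(1) power_mono_iff[of "3 * norm z" "norm (w - c)" q]
    by (metis One_nat_def Suc_le_lessD mult_nonneg_nonneg norm_ge_zero zero_le_numeral)
  then show ?thesis
    using norm_triangle_ineq4[of w c] assms(4) by linarith
qed

definition escape_radius :: "nat \<Rightarrow> complex \<Rightarrow> real" where
  "escape_radius q c = max (3 ^ q) (norm c)"

lemma corr_escapes:
  assumes "1 \<le> q" "q < p" "escape_radius q c \<le> norm z" "w \<in> corr p q c z"
  shows "2 * norm z \<le> norm w"
  using assms corr_doubles_norm unfolding escape_radius_def by auto

lemma escape_radius_pos: "0 < escape_radius q c"
  unfolding escape_radius_def by (simp add: less_max_iff_disj)

lemma bounded_orbit_norm_le_escape_radius:
  assumes "1 \<le> q" "q < p" "forward_orbit p q c \<zeta>" "bounded (range \<zeta>)"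
  shows "norm (\<zeta> i) \<le> escape_radius q c"
proof (rule ccontr)
  assume "\<not> norm (\<zeta> i) \<le> escape_radius q c"
  then have far: "escape_radius q c < norm (\<zeta> i)" by simp
  have growth: "2 ^ n * norm (\<zeta> i) \<le> norm (\<zeta> (i + n))" for n
  proof (induction n)
    case (Suc n)
    have "1 * norm (\<zeta> i) \<le> 2 ^ n * norm (\<zeta> i)"
      by (rule mult_right_mono) auto
    with Suc far have "escape_radius q c \<le> norm (\<zeta> (i + n))" by linarith
    moreover have "\<zeta> (i + Suc n) \<in> corr p q c (\<zeta> (i + n))"
      using assms(3) by (simp add: forward_orbit_def)
    ultimately have "2 * norm (\<zeta> (i + n)) \<le> norm (\<zeta> (i + Suc n))"
      using corr_escapes assms(1,2) by blast
    with Suc show ?case by simp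
  qed simp
  obtain b where b: "\<And>j. norm (\<zeta> j) \<le> b"
    using assms(4) by (auto simp: bounded_iff)
  have pos: "0 < norm (\<zeta> i)" using far escape_radius_pos[of q c] by linarith
  obtain n where "b / norm (\<zeta> i) < 2 ^ n"
    using real_arch_pow[of 2] by auto
  with pos have "b < 2 ^ n * norm (\<zeta> i)" by (simp add: field_simps)
  with growth[of n] b[of "i + n"] show False by linarith
qed

section \<open>Iterated preimages of a trapping disc\<close>

definition corr_preimage :: "nat \<Rightarrow> nat \<Rightarrow> complex \<Rightarrow> complex set \<Rightarrow> complex set" where
  "corr_preimage p q c A = {z. corr p q c z \<inter> A \<noteq> {}}"

definition trapped :: "nat \<Rightarrow> nat \<Rightarrow> complex \<Rightarrow> nat \<Rightarrow> complex set" where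
  "trapped p q c k = (corr_preimage p q c ^^ k) (cball 0 (escape_radius q c))"

lemma trapped_0: "trapped p q c 0 = cball 0 (escape_radius q c)"
  and trapped_Suc: "trapped p q c (Suc k) = corr_preimage p q c (trapped p q c k)"
  by (simp_all add: trapped_def)

lemma corr_preimage_eq_vimage:
  "corr_preimage p q c A = (\<lambda>z. z ^ p) -` ((\<lambda>w. (w - c) ^ q) ` A)"
  by (force simp: corr_preimage_def corr_def)

lemma corr_preimage_mono: "A \<subseteq> B \<Longrightarrow> corr_preimage p q c A \<subseteq> corr_preimage p q c B"
  by (auto simp: corr_preimage_def)

lemma trapped_Suc_subset:
  assumes "1 \<le> q" "q < p"
  shows "trapped p q c (Suc k) \<subseteq> trapped p q c k"
proof (induction k)
  case 0
  show ?case
  proof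
    fix z assume "z \<in> trapped p q c (Suc 0)"
    then obtain w where w: "w \<in> corr p q c z" "norm w \<le> escape_radius q c"
      by (auto simp: trapped_0 trapped_Suc corr_preimage_def)
    show "z \<in> trapped p q c 0"
    proof (rule ccontr)
      assume "z \<notin> trapped p q c 0"
      then have far: "escape_radius q c < norm z" by (simp add: trapped_0)
      with corr_escapes[OF assms _ w(1)] have "2 * norm z \<le> norm w" by simp
      with far w(2) escape_radius_pos[of q c] show False by linarith
    qed
  qed
next
  case (Suc k)
  then show ?case
    by (subst (1 2) trapped_Suc) (rule corr_preimage_mono)
qed

lemma trapped_antimono:
  assumes "1 \<le> q" "q < p" "m \<le> n"
  shows "trapped p q c n \<subseteq> trapped p q c m"
  using assms(3) trapped_Suc_subset[OF assms(1,2)] by (rule lift_Suc_antimono_le[rotated])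

lemma compact_trapped:
  assumes "1 \<le> q" "q < p"
  shows "compact (trapped p q c k)"
proof (induction k)
  case 0
  show ?case by (simp add: trapped_0)
next
  case (Suc k)
  have "compact ((\<lambda>w. (w - c) ^ q) ` trapped p q c k)"
    by (intro compact_continuous_image Suc continuous_intros)
  then have "closed (trapped p q c (Suc k))"
    unfolding trapped_Suc corr_preimage_eq_vimage
    by (intro continuous_closed_vimage compact_imp_closed) (auto intro!: continuous_intros)
  moreover have "bounded (trapped p q c (Suc k))"
    using trapped_antimono[OF assms, of 0 "Suc k" c] bounded_cball bounded_subset
    unfolding trapped_0 by blast
  ultimately show ?case by (simp add: compact_eq_bounded_closed)
qed

text \<open>
  This lets finite orbits be replaced by an infinite one.  A point with orbits of every finite
  length ending in the disc has a successor of the same kind by compactness: the sets of successors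
  that survive \<open>k\<close> more pullbacks are nonempty, compact and decreasing in \<open>k\<close>.
\<close>

lemma trapped_successor:
  assumes "1 \<le> q" "q < p" "z \<in> (\<Inter>k. trapped p q c k)"
  obtains w where "w \<in> corr p q c z" "w \<in> (\<Inter>k. trapped p q c k)"
proof -
  have closed: "closed (corr p q c z)"
    unfolding corr_def by (intro closed_Collect_eq continuous_intros)
  have "(\<Inter>k. corr p q c z \<inter> trapped p q c k) \<noteq> {}"
  proof (rule compact_nest)
    fix k
    show "compact (corr p q c z \<inter> trapped p q c k)"
      using closed compact_trapped[OF assms(1,2)] by (rule closed_Int_compact)
    have "z \<in> trapped p q c (Suc k)" using assms(3) by blast
    then show "corr p q c z \<inter> trapped p q c k \<noteq> {}"
      by (simp add: trapped_Suc corr_preimage_def)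
  qed (use trapped_antimono[OF assms(1,2)] in blast)
  with that show ?thesis by blast
qed

lemma filled_julia_eq_Inter_trapped:
  assumes "1 \<le> q" "q < p"
  shows "filled_julia p q c = (\<Inter>k. trapped p q c k)"
proof (intro equalityI subsetI)
  fix z assume "z \<in> filled_julia p q c"
  then obtain \<zeta> where \<zeta>: "forward_orbit p q c \<zeta>" "\<zeta> 0 = z" "bounded (range \<zeta>)"
    by (auto simp: filled_julia_def)
  have "\<zeta> i \<in> trapped p q c k" for i k
  proof (induction k arbitrary: i)
    case 0
    show ?case
      using bounded_orbit_norm_le_escape_radius[OF assms \<zeta>(1,3)] by (simp add: trapped_0)
  next
    case (Suc k)
    then show ?case
      using \<zeta>(1) by (auto simp: trapped_Suc corr_preimage_def forward_orbit_def)
  qed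
  with \<zeta>(2) show "z \<in> (\<Inter>k. trapped p q c k)" by auto
next
  fix z assume z: "z \<in> (\<Inter>k. trapped p q c k)"
  let ?K = "\<Inter>k. trapped p q c k"
  have "\<exists>\<zeta>. \<forall>n. (\<zeta> n \<in> ?K \<and> (n = 0 \<longrightarrow> \<zeta> n = z)) \<and>
      \<zeta> (Suc n) \<in> corr p q c (\<zeta> n)"
  proof (rule dependent_nat_choice)
    show "\<exists>x. x \<in> ?K \<and> (0 = (0::nat) \<longrightarrow> x = z)"
      using z by blast
  next
    fix x and n :: nat
    assume "x \<in> ?K \<and> (n = 0 \<longrightarrow> x = z)"
    then obtain w where "w \<in> corr p q c x" "w \<in> ?K"
      using trapped_successor[OF assms] by metis
    then show "\<exists>y. (y \<in> ?K \<and> (Suc n = 0 \<longrightarrow> y = z)) \<and> y \<in> corr p q c x"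
      by blast
  qed
  then obtain \<zeta> where \<zeta>: "\<And>n. \<zeta> n \<in> ?K" "\<zeta> 0 = z"
      "\<And>n. \<zeta> (Suc n) \<in> corr p q c (\<zeta> n)"
    by metis
  have "\<zeta> n \<in> trapped p q c 0" for n
    using \<zeta>(1) by blast
  then have "range \<zeta> \<subseteq> cball 0 (escape_radius q c)"
    unfolding trapped_0 by blast
  then have "bounded (range \<zeta>)"
    using bounded_cball bounded_subset by blast
  moreover have "forward_orbit p q c \<zeta>"
    using \<zeta>(3) by (simp add: forward_orbit_def)
  ultimately show "z \<in> filled_julia p q c"
    using \<zeta>(2) unfolding filled_julia_def by blast
qed

section \<open>Connectedness of the filled Julia set\<close>

text \<open>
  The hypothesis \<open>c \<in> A\<close> puts the critical value \<open>0\<close> of \<open>z \<mapsto> z\<^sup>p\<close> into the image of \<open>A\<close> under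
  \<open>w \<mapsto> (w - c)\<^sup>q\<close>; without it the inverse image could split into several pieces permuted by the
  \<open>p\<close>-th roots of unity.
\<close>

lemma connected_corr_preimage:
  assumes "1 \<le> q" "1 \<le> p" "connected A" "c \<in> A" "compact (corr_preimage p q c A)"
  shows "connected (corr_preimage p q c A)"
  unfolding corr_preimage_eq_vimage
proof (rule connected_vimage_open_map)
  show "connected ((\<lambda>w. (w - c) ^ q) ` A)"
    by (intro connected_continuous_image assms continuous_intros)
  show "0 \<in> (\<lambda>w. (w - c) ^ q) ` A"
    using assms(1,4) by (force simp: image_iff)
  show "(\<lambda>z::complex. z ^ p) -` {0} = {0}"
    using assms(2) by auto
  show "compact ((\<lambda>z. z ^ p) -` ((\<lambda>w. (w - c) ^ q) ` A))"
    using assms(5) unfolding corr_preimage_eq_vimage .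
  show "surj (\<lambda>z::complex. z ^ p)"
    using assms(2) by (intro surj_complex_power) simp
  show "open ((\<lambda>z::complex. z ^ p) ` U)" if "open U" for U
    using assms(2) that by (intro open_image_complex_power) simp_all
qed (intro continuous_intros)

text \<open>
  The critical value \<open>c\<close> lies in every stage because it is the only successor of \<open>0\<close>, and \<open>0\<close> lies
  in the next stage.
\<close>

lemma connected_trapped:
  assumes "1 \<le> q" "q < p" "0 \<in> filled_julia p q c"
  shows "connected (trapped p q c k)"
proof (induction k)
  case 0
  show ?case by (simp add: trapped_0)
next
  case (Suc k)
  have "0 \<in> trapped p q c (Suc k)"
    using assms filled_julia_eq_Inter_trapped by blast
  then obtain w where w: "w \<in> trapped p q c k" "(w - c) ^ q = 0 ^ p"
    by (auto simp: trapped_Suc corr_preimage_def corr_def)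
  have "(0::complex) ^ p = 0"
    using assms(2) by (intro zero_power) simp
  with w(2) have "w = c" by simp
  with w(1) have "c \<in> trapped p q c k" by simp
  then show ?case
    using connected_corr_preimage[OF assms(1) _ Suc] compact_trapped[OF assms(1,2), of c "Suc k"]
      assms(1,2) by (simp add: trapped_Suc)
qed

theorem theorem2p1:
  fixes p q :: nat
  assumes "1 \<le> q" and "q < p"
  shows "zero_locus p q \<subseteq> connectedness_locus p q"
proof
  fix c assume "c \<in> zero_locus p q"
  then have "0 \<in> filled_julia p q c" by (simp add: zero_locus_def)
  then have "connected (\<Inter>k. trapped p q c k)"
    using compact_trapped connected_trapped trapped_antimono assms by (intro connected_nest) auto
  then show "c \<in> connectedness_locus p q"
    using filled_julia_eq_Inter_trapped[OF assms] by (simp add: connectedness_locus_def)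
qed

end
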